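(* Let $T_0>0$ and $c=\max_{i\in E,\,a\in\mathcal A}|c_i(a)|$. Then $$|U(T,\vec\pi,a)-U(S,\vec\pi,a)|\le c\,|T-S|\qquad\text{for all }\vec\pi\in D,\ T,S\in(0,T_0],\ a\in\mathcal A.$$
   Context: Model. $E=\{1,\dots,m\}$ (states) and $\mathcal A=\{1,\dots,A\}$ (policies) are finite sets. $M=(M_t)_{t\ge0}$ is an unobserved continuous-time Markov chain on $E$ with generator $Q=(q_{ij})_{i,j\in E}$. $\lambda_1,\dots,\lambda_m>0$ are constants, $\nu_1,\dots,\nu_m$ are probability distributions on $\mathbb R^d$, $\nu=\nu_1+\cdots+\nu_m$, and $f_i=d\nu_i/d\nu$. The observed process is $X_t=X_0+\int_0^t\sum_{i\in E}1_{\{M_s=i\}}\,dX^{(i)}_s$, where $X^{(1)},\dots,X^{(m)}$ are independent compound Poisson processes, independent of $M$, $X^{(i)}$ having intensity $\lambda_i$ and jump distribution $\nu_i$. $0=\sigma_0<\sigma_1<\sigma_2<\cdots$ are the arrival (jump) times of $X$ and $Y_\ell=X_{\sigma_\ell}-X_{\sigma_\ell-}$ the marks. $\mathbb F=(\mathcal F^X_t)_{t\ge0}$ is the natural filtration of $X$ augmented by null sets. $D=\{\vec\pi\in[0,1]^m:\pi_1+\cdots+\pi_m=1\}$. Under $\mathbb P^{\vec\pi}$, $M_0$ has law $\vec\pi$; $\mathbb E^{\vec\pi,a}$ is the corresponding expectation, when the initial policy is $a$. Conditional probability process. $\vec\Pi_t=\vec\Pi(t)=(\Pi_1(t),\dots,\Pi_m(t))$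 with $\Pi_i(t)=\mathbb P^{\vec\pi}\{M_t=i\mid\mathcal F^X_t\}$, taken in its right-continuous version: $\vec\Pi(t)=\vec x(t-\sigma_\ell,\vec\Pi(\sigma_\ell))$ for $\sigma_\ell\le t<\sigma_{\ell+1}$, and $\Pi_i(\sigma_\ell)=\lambda_if_i(Y_\ell)\Pi_i(\sigma_\ell-)/\sum_{j\in E}\lambda_jf_j(Y_\ell)\Pi_j(\sigma_\ell-)$ for $\ell\ge1$, where $x_i(t,\vec\pi)=m_i(t,\vec\pi)/\sum_{j\in E}m_j(t,\vec\pi)$, $\vec m(t,\vec\pi)=\vec\pi\,e^{t(Q-\Lambda)}$, $\Lambda=\mathrm{diag}(\lambda_1,\dots,\lambda_m)$. Costs. $\rho\ge0$ is the discount factor; $c_i(a)\in\mathbb R$ are running benefit rates; switching costs satisfy $K_i(a,b)+K_i(b,c)\ge K_i(a,c)$ and $K_i(a,b)>k_0>0$ for all $i\in E$, $a,b,c\in\mathcal A$, for some constant $k_0$. $C(\vec\pi,a)=\sum_{i\in E}c_i(a)\pi_i$, $K(a,b,\vec\pi)=\sum_{i\in E}K_i(a,b)\pi_i$. Strategies and value function. For $T\in\mathbb R_+=[0,\infty)$, an admissible strategy $\xi\in\mathcal U(T)$ with initial policy $a$ is a sequence $(\tau_k,\xi_k)_{k\ge0}$ with $\tau_0=0$, $\xi_0=a$, $0=\tau_0<\tau_1<\cdots\le T$ $\mathbb F$-stopping times (switching times), $\xi_k$ an $\mathcal A$-valued $\mathcal F^X_{\tau_k}$-measurable random variable, almost surely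 finitely many switches, and $\mathbb E^{\vec\pi,a}[\sum_{k\ge1}e^{-\rho\tau_k}K(\xi_{k-1},\xi_k,\vec\Pi(\tau_k))]<\infty$; it is identified with the process $\xi_t=\xi_k$ for $\tau_k\le t<\tau_{k+1}$. Its performance is $$J^\xi(T,\vec\pi,a)=\mathbb E^{\vec\pi,a}\Big[\int_0^Te^{-\rho t}\sum_{i\in E}c_i(\xi_t)1_{\{M_t=i\}}dt-\sum_{k\ge1}e^{-\rho\tau_k}\sum_{i\in E}K_i(\xi_{k-1},\xi_k)1_{\{M_{\tau_k}=i\}}\Big],$$ equivalently $\mathbb E^{\vec\pi,a}[\int_0^Te^{-\rho t}C(\vec\Pi_t,\xi_t)dt-\sum_{k\ge1}e^{-\rho\tau_k}K(\xi_{k-1},\xi_k,\vec\Pi_{\tau_k})]$. The value function is $U(T,\vec\pi,a)=\sup_{\xi\in\mathcal U(T)}J^\xi(T,\vec\pi,a)$. *)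

theory Defs
  imports "HOL-Probability.Probability"
begin

text \<open>
  States are the elements of a finite type \<open>'e\<close>, policies those of a finite type \<open>'a\<close>,
  and marks live in \<open>real ^ 'd\<close>.  A random process is a function \<open>real \<Rightarrow> 'w \<Rightarrow> _\<close>, of which only
  the times \<open>t \<ge> 0\<close> matter.
\<close>

subsection \<open>The hidden Markov chain\<close>

definition prob_simplex :: "(real ^ 'e::finite) set" where
  "prob_simplex = {p. (\<forall>i. p $ i \<in> {0..1}) \<and> (\<Sum>i\<in>UNIV. p $ i) = 1}"

definition mat_exp :: "real ^ 'e ^ 'e \<Rightarrow> real ^ 'e ^ 'e::finite" where
  "mat_exp A = (\<Sum>n. (((\<lambda>B. A ** B) ^^ n) (mat 1)) /\<^sub>R fact n)"

definition generator_matrix :: "real ^ 'e ^ 'e::finite \<Rightarrow> bool" where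
  "generator_matrix Q \<longleftrightarrow>
     (\<forall>i j. i \<noteq> j \<longrightarrow> Q $ i $ j \<ge> 0) \<and> (\<forall>i. (\<Sum>j\<in>UNIV. Q $ i $ j) = 0)"

text \<open>
  The Markov property is expressed by the finite-dimensional distributions; the case \<open>n = 0\<close> says
  that the initial law is \<open>p\<close>.  Paths are right-continuous for the discrete topology.
\<close>

definition markov_chain_process ::
  "'w measure \<Rightarrow> real ^ 'e \<Rightarrow> real ^ 'e ^ 'e \<Rightarrow> (real \<Rightarrow> 'w \<Rightarrow> 'e::finite) \<Rightarrow> bool" where
  "markov_chain_process N p Q M \<longleftrightarrow>
     generator_matrix Q \<and>
     (\<forall>t\<ge>0. M t \<in> N \<rightarrow>\<^sub>M count_space UNIV) \<and>
     (\<forall>\<omega>\<in>space N. \<forall>t\<ge>0. \<forall>\<^sub>F s in at_right t. M s \<omega> = M t \<omega>) \<and>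
     (\<forall>n (t :: nat \<Rightarrow> real) s. t 0 = 0 \<and> (\<forall>k<n. t k \<le> t (Suc k)) \<longrightarrow>
        measure N {\<omega> \<in> space N. \<forall>k\<le>n. M (t k) \<omega> = s k} =
        p $ s 0 * (\<Prod>k<n. mat_exp ((t (Suc k) - t k) *\<^sub>R Q) $ s k $ s (Suc k)))"

subsection \<open>The observed process\<close>

text \<open>
  \<open>S n\<close> are the interarrival times and \<open>Z n\<close> the jumps; the law of the pair being a product,
  all of these variables are mutually independent.  The defining identity is only required up to
  indistinguishability, since on a null set the arrival times may accumulate.
\<close>

definition compound_poisson_process ::
  "'w measure \<Rightarrow> real \<Rightarrow> (real ^ 'd) measure \<Rightarrow> (real \<Rightarrow> 'w \<Rightarrow> real ^ 'd::finite) \<Rightarrow> bool" where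
  "compound_poisson_process N l \<nu> Y \<longleftrightarrow>
     (\<forall>t\<ge>0. Y t \<in> borel_measurable N) \<and>
     (\<exists>(S :: nat \<Rightarrow> 'w \<Rightarrow> real) (Z :: nat \<Rightarrow> 'w \<Rightarrow> real ^ 'd).
        prob_space.indep_vars N (\<lambda>_. borel \<Otimes>\<^sub>M borel) (\<lambda>n \<omega>. (S n \<omega>, Z n \<omega>)) UNIV \<and>
        (\<forall>n. distr N (borel \<Otimes>\<^sub>M borel) (\<lambda>\<omega>. (S n \<omega>, Z n \<omega>)) =
               density lborel (exponential_density l) \<Otimes>\<^sub>M \<nu>) \<and>
        (AE \<omega> in N. \<forall>t\<ge>0. Y t \<omega> = (\<Sum>n | (\<Sum>k\<le>n. S k \<omega>) \<le> t. Z n \<omega>)))"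

definition jump :: "(real \<Rightarrow> 'b::real_normed_vector) \<Rightarrow> real \<Rightarrow> 'b" where
  "jump y s = y s - Lim (at_left s) y"

text \<open>
  The integral \<open>\<integral>\<^sub>(\<^sub>0\<^sub>,\<^sub>t\<^sub>] h s dy\<^sub>s\<close> against a right-continuous path \<open>y\<close> that is piecewise constant with
  finitely many jumps on bounded intervals.
\<close>

definition jump_integral :: "(real \<Rightarrow> real) \<Rightarrow> (real \<Rightarrow> 'b::real_normed_vector) \<Rightarrow> real \<Rightarrow> 'b" where
  "jump_integral h y t = (\<Sum>s | 0 < s \<and> s \<le> t \<and> jump y s \<noteq> 0. h s *\<^sub>R jump y s)"

definition process_events ::
  "'w set \<Rightarrow> real set \<Rightarrow> 's measure \<Rightarrow> (real \<Rightarrow> 'w \<Rightarrow> 's) \<Rightarrow> 'w set set" where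
  "process_events \<Omega> I S Y = {Y t -` A \<inter> \<Omega> | t A. t \<in> I \<and> A \<in> sets S}"

text \<open>The model under a single measure \<open>N\<close>, the initial law of the chain being \<open>p\<close>.\<close>

definition hidden_markov_observation ::
  "'w measure \<Rightarrow> real ^ 'e \<Rightarrow> real ^ 'e ^ 'e \<Rightarrow> ('e \<Rightarrow> real) \<Rightarrow> ('e \<Rightarrow> (real ^ 'd) measure) \<Rightarrow>
   (real \<Rightarrow> 'w \<Rightarrow> 'e::finite) \<Rightarrow> ('e \<Rightarrow> real \<Rightarrow> 'w \<Rightarrow> real ^ 'd::finite) \<Rightarrow>
   (real \<Rightarrow> 'w \<Rightarrow> real ^ 'd) \<Rightarrow> bool" where
  "hidden_markov_observation N p Q lam \<nu> M Xi X \<longleftrightarrow>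
     prob_space N \<and>
     markov_chain_process N p Q M \<and>
     (\<forall>i. lam i > 0) \<and>
     (\<forall>i. prob_space (\<nu> i) \<and> sets (\<nu> i) = sets borel) \<and>
     (\<forall>i. compound_poisson_process N (lam i) (\<nu> i) (Xi i)) \<and>
     prob_space.indep_sets N
       (\<lambda>j. case j of
           None \<Rightarrow> sigma_sets (space N) (process_events (space N) {0..} (count_space UNIV) M)
         | Some i \<Rightarrow> sigma_sets (space N) (process_events (space N) {0..} borel (Xi i))) UNIV \<and>
     (\<forall>t\<ge>0. X t \<in> borel_measurable N) \<and>
     (AE \<omega> in N. \<forall>t\<ge>0. X t \<omega> = X 0 \<omega> +
        (\<Sum>i\<in>UNIV. jump_integral (\<lambda>s. of_bool (M s \<omega> = i)) (\<lambda>s. Xi i s \<omega>) t))"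

text \<open>
  The natural filtration of \<open>X\<close>, augmented by the null sets of \<open>N\<close>.  The time index is
  \<open>ennreal\<close> because stopping times may be infinite; the \<open>\<sigma>\<close>-algebra at \<open>\<infinity>\<close> is generated by all
  earlier ones.
\<close>

definition obs_filtration ::
  "'w measure \<Rightarrow> (real \<Rightarrow> 'w \<Rightarrow> real ^ 'd::finite) \<Rightarrow> ennreal \<Rightarrow> 'w measure" where
  "obs_filtration N X t = sigma (space N)
     (process_events (space N) {s. 0 \<le> s \<and> ennreal s \<le> t} borel X \<union> null_sets N)"

text \<open>
  A right-continuous version of the conditional law of \<open>M t\<close> given the observations up to \<open>t\<close>; it
  is unique up to indistinguishability.  In the usual case (\<open>X 0\<close> independent of the rest, no
  \<open>\<nu> i\<close> charging \<open>0\<close>) the explicit filter is such a version: the normalised flow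
  \<open>p exp (t (Q - \<Lambda>))\<close> between arrivals, and Bayes' rule with the densities of the \<open>\<nu> i\<close> at arrivals.
\<close>

definition conditional_prob_process ::
  "'w measure \<Rightarrow> (real \<Rightarrow> 'w \<Rightarrow> real ^ 'd::finite) \<Rightarrow> (real \<Rightarrow> 'w \<Rightarrow> 'e::finite) \<Rightarrow>
   (real \<Rightarrow> 'w \<Rightarrow> real ^ 'e) \<Rightarrow> bool" where
  "conditional_prob_process N X M \<pi> \<longleftrightarrow>
     (\<forall>t\<ge>0. \<pi> t \<in> borel_measurable (obs_filtration N X (ennreal t))) \<and>
     (\<forall>t\<ge>0. \<forall>i. AE \<omega> in N. \<pi> t \<omega> $ i =
        real_cond_exp N (obs_filtration N X (ennreal t)) (\<lambda>\<omega>. of_bool (M t \<omega> = i)) \<omega>) \<and>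
     (AE \<omega> in N. \<forall>t\<ge>0. continuous (at_right t) (\<lambda>s. \<pi> s \<omega>))"

subsection \<open>Strategies and the value function\<close>

definition switch_cost :: "('e \<Rightarrow> 'a \<Rightarrow> 'a \<Rightarrow> real) \<Rightarrow> 'a \<Rightarrow> 'a \<Rightarrow> real ^ 'e::finite \<Rightarrow> real" where
  "switch_cost K a b p = (\<Sum>i\<in>UNIV. K i a b * p $ i)"

text \<open>
  A strategy is a pair of switching times \<open>\<tau> k\<close> and policies \<open>\<xi> k\<close>.  The value \<open>\<tau> k \<omega> = \<infinity>\<close> means
  that fewer than \<open>k\<close> switches are made; such indices contribute no cost.
\<close>

type_synonym ('w, 'a) strategy = "(nat \<Rightarrow> 'w \<Rightarrow> ennreal) \<times> (nat \<Rightarrow> 'w \<Rightarrow> 'a)"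

definition admissible_strategies ::
  "'w measure \<Rightarrow> (real \<Rightarrow> 'w \<Rightarrow> real ^ 'd::finite) \<Rightarrow> (real \<Rightarrow> 'w \<Rightarrow> real ^ 'e::finite) \<Rightarrow>
   real \<Rightarrow> ('e \<Rightarrow> 'a \<Rightarrow> 'a \<Rightarrow> real) \<Rightarrow> real \<Rightarrow> 'a \<Rightarrow> ('w, 'a) strategy set" where
  "admissible_strategies N X \<pi> \<rho> K T a = {(\<tau>, \<xi>).
     (\<forall>\<omega>\<in>space N. \<tau> 0 \<omega> = 0 \<and> \<xi> 0 \<omega> = a) \<and>
     (\<forall>\<omega>\<in>space N. \<forall>k. \<tau> k \<omega> < \<tau> (Suc k) \<omega> \<or> \<tau> k \<omega> = \<infinity> \<and> \<tau> (Suc k) \<omega> = \<infinity>) \<and>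
     (\<forall>\<omega>\<in>space N. \<forall>k. \<tau> k \<omega> \<le> ennreal T \<or> \<tau> k \<omega> = \<infinity>) \<and>
     (\<forall>k. stopping_time (obs_filtration N X) (\<tau> k)) \<and>
     (\<forall>k. \<xi> k \<in> filtration.pre_sigma (space N) (obs_filtration N X) (\<tau> k) \<rightarrow>\<^sub>M count_space UNIV) \<and>
     (AE \<omega> in N. \<exists>k. \<tau> k \<omega> = \<infinity>) \<and>
     (\<integral>\<^sup>+ \<omega>. (\<Sum>k. if \<tau> (Suc k) \<omega> = \<infinity> then 0 else
        ennreal (exp (- \<rho> * enn2real (\<tau> (Suc k) \<omega>)) *
          switch_cost K (\<xi> k \<omega>) (\<xi> (Suc k) \<omega>) (\<pi> (enn2real (\<tau> (Suc k) \<omega>)) \<omega>))) \<partial>N) < \<infinity>}"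

definition policy_at :: "('w, 'a) strategy \<Rightarrow> real \<Rightarrow> 'w \<Rightarrow> 'a" where
  "policy_at = (\<lambda>(\<tau>, \<xi>) t \<omega>. \<xi> (THE k. \<tau> k \<omega> \<le> ennreal t \<and> ennreal t < \<tau> (Suc k) \<omega>) \<omega>)"

definition performance ::
  "'w measure \<Rightarrow> (real \<Rightarrow> 'w \<Rightarrow> 'e::finite) \<Rightarrow> real \<Rightarrow> ('e \<Rightarrow> 'a \<Rightarrow> real) \<Rightarrow>
   ('e \<Rightarrow> 'a \<Rightarrow> 'a \<Rightarrow> real) \<Rightarrow> real \<Rightarrow> ('w, 'a) strategy \<Rightarrow> real" where
  "performance N M \<rho> c K T = (\<lambda>(\<tau>, \<xi>).
     (\<integral>\<omega>. (\<integral>t\<in>{0..T}. exp (- \<rho> * t) *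
              (\<Sum>i\<in>UNIV. c i (policy_at (\<tau>, \<xi>) t \<omega>) * of_bool (M t \<omega> = i)) \<partial>lborel)
        - (\<Sum>k. if \<tau> (Suc k) \<omega> = \<infinity> then 0 else
             exp (- \<rho> * enn2real (\<tau> (Suc k) \<omega>)) *
             (\<Sum>i\<in>UNIV. K i (\<xi> k \<omega>) (\<xi> (Suc k) \<omega>) *
                of_bool (M (enn2real (\<tau> (Suc k) \<omega>)) \<omega> = i))) \<partial>N))"

definition value_function ::
  "'w measure \<Rightarrow> (real \<Rightarrow> 'w \<Rightarrow> real ^ 'd::finite) \<Rightarrow> (real \<Rightarrow> 'w \<Rightarrow> 'e::finite) \<Rightarrow>
   (real \<Rightarrow> 'w \<Rightarrow> real ^ 'e) \<Rightarrow> real \<Rightarrow> ('e \<Rightarrow> 'a \<Rightarrow> real) \<Rightarrow> ('e \<Rightarrow> 'a \<Rightarrow> 'a \<Rightarrow> real) \<Rightarrow>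
   real \<Rightarrow> 'a \<Rightarrow> real" where
  "value_function N X M \<pi> \<rho> c K T a =
     (SUP s \<in> admissible_strategies N X \<pi> \<rho> K T a. performance N M \<rho> c K T s)"

end

theory Submission
  imports Defs
begin

text \<open>
  Let \<open>S \<le> T\<close>.  Strategies for horizon \<open>S\<close> are also admissible for \<open>T\<close>, and a strategy for horizon
  \<open>T\<close> becomes one for \<open>S\<close> by cancelling all switches after \<open>S\<close>, which only lowers the costs.  In
  both cases the running gains differ by an integral over \<open>(S, T]\<close> of a function bounded by
  \<open>max \<bar>c\<bar>\<close>.  To integrate these pathwise comparisons, the switching costs must be shown integrable:
  otherwise the Bochner integral in the performance would have the junk value \<open>0\<close>.
\<close>

section \<open>Joint measurability of right-continuous discrete processes\<close>

text \<open>Turns limits from the right into sequential ones, for the grid points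
  \<open>r n t\<close> and later for rational times. The lower bound is strict because
  \<open>at_right t\<close> excludes \<open>t\<close>.\<close>

lemma filterlim_at_right_sequentially:
  fixes r :: "nat \<Rightarrow> real"
  assumes "\<And>n. t < r n" "\<And>n. r n \<le> t + 1 / real (Suc n)"
  shows "filterlim r (at_right t) sequentially"
proof (rule tendsto_imp_filterlim_at_right)
  have "(\<lambda>n. t + 1 / real (Suc n)) \<longlonglongrightarrow> t + 0"
    by (intro tendsto_add tendsto_const LIMSEQ_Suc[OF lim_1_over_n])
  then show "r \<longlonglongrightarrow> t"
    by (intro tendsto_sandwich[OF _ _ tendsto_const, of t r sequentially "\<lambda>n. t + 1 / real (Suc n)"])
       (use assms in \<open>auto intro!: always_eventually less_imp_le simp del: of_nat_Suc\<close>)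
qed (use assms in auto)

text \<open>Provides the joint measurability that Fubini's theorem requires, and measurability of
  the chain at a random time. Negative times are sent to 0, since the assumptions concern
  \<open>t \<ge> 0\<close> only.\<close>

lemma measurable_right_continuous_process:
  fixes M :: "real \<Rightarrow> 'w \<Rightarrow> 'e::countable"
  assumes M: "\<And>t. t \<ge> 0 \<Longrightarrow> M t \<in> N \<rightarrow>\<^sub>M count_space UNIV"
    and right_cont: "\<And>\<omega> t. \<omega> \<in> space N \<Longrightarrow> t \<ge> 0 \<Longrightarrow> \<forall>\<^sub>F s in at_right t. M s \<omega> = M t \<omega>"
  shows "(\<lambda>(\<omega>, t). M (max 0 t) \<omega>) \<in> N \<Otimes>\<^sub>M borel \<rightarrow>\<^sub>M count_space UNIV"
proof -
  \<comment> \<open>Approximate \<open>t\<close> strictly from the right by countably valued \<open>r n t\<close>; in the discrete topology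
    \<open>M\<close> is then eventually constant along \<open>r n t\<close>.\<close>
  define r :: "nat \<Rightarrow> real \<Rightarrow> real" where "r n t = (of_int \<lfloor>real (Suc n) * t\<rfloor> + 1) / real (Suc n)" for n t
  have r: "t < r n t" "r n t \<le> t + 1 / real (Suc n)" for n t
  proof -
    have "real (Suc n) * t < of_int \<lfloor>real (Suc n) * t\<rfloor> + 1"
      by linarith
    then show "t < r n t" by (simp add: r_def field_simps)
    have "of_int \<lfloor>real (Suc n) * t\<rfloor> \<le> real (Suc n) * t" by (rule of_int_floor_le)
    then show "r n t \<le> t + 1 / real (Suc n)"
      unfolding r_def by (simp add: add_divide_distrib divide_le_eq mult.commute del: of_nat_Suc)
  qed
  have lim: "filterlim (\<lambda>n. r n t) (at_right t) sequentially" for t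
    by (rule filterlim_at_right_sequentially[OF r])
  have step[measurable]: "(\<lambda>x. M (r n (max 0 (snd x))) (fst x)) \<in> N \<Otimes>\<^sub>M borel \<rightarrow>\<^sub>M count_space UNIV" for n
  proof -
    have [measurable]: "M (max 0 u) \<in> N \<rightarrow>\<^sub>M count_space UNIV" for u by (rule M) simp
    \<comment> \<open>On each level set of the floor the time is constant, so only single variables
      \<open>M u\<close> enter, and there are countably many such sets.\<close>
    have "(\<lambda>x. M (max 0 ((of_int \<lfloor>real (Suc n) * max 0 (snd x)\<rfloor> + 1) / real (Suc n))) (fst x))
        \<in> N \<Otimes>\<^sub>M borel \<rightarrow>\<^sub>M count_space UNIV"
      by (rule measurable_compose_countable[where g = "\<lambda>x. \<lfloor>real (Suc n) * max 0 (snd x)\<rfloor>"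
            and f = "\<lambda>k x. M (max 0 ((of_int k + 1) / real (Suc n))) (fst x)"]) measurable
    moreover have "max 0 (r n (max 0 t)) = r n (max 0 t)" for t
      using r(1)[of "max 0 t" n] by simp
    ultimately show ?thesis by (simp add: r_def)
  qed
  \<comment> \<open>The event that the chain is in \<open>i\<close> is the lower limit of the events
    at the approximating times, hence a countable combination of them.\<close>
  have "Measurable.pred (N \<Otimes>\<^sub>M borel) (\<lambda>x. \<exists>m. \<forall>n\<ge>m. M (r n (max 0 (snd x))) (fst x) = i)" for i
    by measurable
  also have "(\<lambda>x. \<exists>m. \<forall>n\<ge>m. M (r n (max 0 (snd x))) (fst x) = i) x \<longleftrightarrow> M (max 0 (snd x)) (fst x) = i"
    if "x \<in> space (N \<Otimes>\<^sub>M borel)" for x i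
  proof -
    have "\<forall>\<^sub>F n in sequentially. M (r n (max 0 (snd x))) (fst x) = M (max 0 (snd x)) (fst x)"
      using right_cont[of "fst x" "max 0 (snd x)"] that lim[of "max 0 (snd x)"]
      by (auto simp: space_pair_measure filterlim_iff)
    then obtain m where m: "\<And>n. n \<ge> m \<Longrightarrow> M (r n (max 0 (snd x))) (fst x) = M (max 0 (snd x)) (fst x)"
      by (auto simp: eventually_sequentially)
    \<comment> \<open>Two tails with different starting indices meet at their maximum.\<close>
    then show ?thesis by (metis max.cobounded1 max.cobounded2)
  qed
  note * = this
  have pred: "Measurable.pred (N \<Otimes>\<^sub>M borel) (\<lambda>x. M (max 0 (snd x)) (fst x) = i)" for i
    by (subst measurable_cong[OF *[symmetric]]) measurable
  show ?thesis
    unfolding case_prod_beta'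
    by (intro measurable_count_space_eq2_countable[THEN iffD2])
       (use pred in \<open>auto simp: pred_def vimage_def Int_def conj_commute\<close>)
qed

section \<open>The augmented observation filtration\<close>

text \<open>\<open>sigma\<close> yields the generated sigma-algebra only for a family of subsets of
  the space, which is checked here.\<close>

lemma sets_obs_filtration:
  "sets (obs_filtration N X t) = sigma_sets (space N)
     (process_events (space N) {s. 0 \<le> s \<and> ennreal s \<le> t} borel X \<union> null_sets N)"
  and space_obs_filtration: "space (obs_filtration N X t) = space N"
proof -
  have "process_events (space N) {s. 0 \<le> s \<and> ennreal s \<le> t} borel X \<union> null_sets N \<subseteq> Pow (space N)"
    using sets.sets_into_space by (fastforce simp: process_events_def)
  then show "sets (obs_filtration N X t) = sigma_sets (space N)
     (process_events (space N) {s. 0 \<le> s \<and> ennreal s \<le> t} borel X \<union> null_sets N)"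
    "space (obs_filtration N X t) = space N"
    by (simp_all add: obs_filtration_def)
qed

lemma filtration_obs_filtration: "filtration (space N) (obs_filtration N X)"
proof
  show "sets (obs_filtration N X s) \<subseteq> sets (obs_filtration N X t)" if "s \<le> t" for s t
    unfolding sets_obs_filtration using that
    by (intro sigma_sets_mono') (auto simp: process_events_def intro: order_trans)
qed (rule space_obs_filtration)

lemma subalgebra_obs_filtration:
  assumes "\<And>t. t \<ge> 0 \<Longrightarrow> X t \<in> borel_measurable N"
  shows "subalgebra N (obs_filtration N X t)"
proof -
  have "process_events (space N) {s. 0 \<le> s \<and> ennreal s \<le> t} borel X \<union> null_sets N \<subseteq> sets N"
    using assms by (auto simp: process_events_def intro: measurable_sets)
  then show ?thesis
    by (simp add: subalgebra_def space_obs_filtration sets_obs_filtration sets.sigma_sets_subset)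
qed

section \<open>The probability simplex\<close>

lemma closed_prob_simplex: "closed prob_simplex"
proof -
  have "prob_simplex = (\<Inter>i. {p. 0 \<le> p $ i} \<inter> {p. p $ i \<le> 1}) \<inter> {p::real^'e::finite. (\<Sum>i\<in>UNIV. p $ i) = 1}"
    by (auto simp: prob_simplex_def)
  also have "closed \<dots>"
    by (intro closed_Int closed_INT ballI closed_Collect_le closed_Collect_eq continuous_intros)
  finally show ?thesis .
qed

lemma prob_simplexI:
  assumes "\<And>i. p $ i \<ge> 0" "(\<Sum>i\<in>UNIV. p $ i) = 1" shows "p \<in> prob_simplex"
  using assms member_le_sum[of _ UNIV "\<lambda>i. p $ i"] by (auto simp: prob_simplex_def)

lemma switch_cost_ge:
  assumes "\<And>i. K i a b \<ge> k" "p \<in> prob_simplex" shows "switch_cost K a b p \<ge> k"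
proof -
  have "k = (\<Sum>i\<in>UNIV. k * p $ i)"
    using assms(2) by (simp add: prob_simplex_def flip: sum_distrib_left)
  also have "\<dots> \<le> switch_cost K a b p"
    unfolding switch_cost_def using assms by (intro sum_mono mult_right_mono) (auto simp: prob_simplex_def)
  finally show ?thesis .
qed

section \<open>The model under one initial law\<close>

text \<open>Works with a single initial law: \<open>N\<close> stands for \<open>P p\<close>, and
  \<open>\<pi>\<close> for \<open>\<pi> p\<close>.\<close>

locale switching_model = prob_space N
  for N :: "'w measure" +
  fixes M :: "real \<Rightarrow> 'w \<Rightarrow> 'e::finite"
    and X :: "real \<Rightarrow> 'w \<Rightarrow> real ^ 'd::finite"
    and \<pi> :: "real \<Rightarrow> 'w \<Rightarrow> real ^ 'e"
    and c :: "'e \<Rightarrow> 'a::finite \<Rightarrow> real"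
    and K :: "'e \<Rightarrow> 'a \<Rightarrow> 'a \<Rightarrow> real"
    and \<rho> k0 :: real
  assumes measurable_M: "\<And>t. t \<ge> 0 \<Longrightarrow> M t \<in> N \<rightarrow>\<^sub>M count_space UNIV"
    and right_cont_M: "\<And>\<omega> t. \<omega> \<in> space N \<Longrightarrow> t \<ge> 0 \<Longrightarrow> \<forall>\<^sub>F s in at_right t. M s \<omega> = M t \<omega>"
    and measurable_X: "\<And>t. t \<ge> 0 \<Longrightarrow> X t \<in> borel_measurable N"
    and cond_prob: "conditional_prob_process N X M \<pi>"
    and discount: "\<rho> \<ge> 0"
    and k0_pos: "k0 > 0"
    and cost_lower: "\<And>i a b. K i a b > k0"
begin

sublocale filtration "space N" "obs_filtration N X"
  by (rule filtration_obs_filtration)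

text \<open>At a fixed time the coordinates are nonnegative conditional expectations with sum 1.
  Rational times share one null set, and right-continuity with closedness of the simplex reaches all
  other times. One common null set is required because switching times are random.\<close>

lemma AE_cond_prob_simplex: "AE \<omega> in N. \<forall>t\<ge>0. \<pi> t \<omega> \<in> prob_simplex"
proof -
  have fixed: "AE \<omega> in N. \<pi> t \<omega> \<in> prob_simplex" if t: "t \<ge> 0" for t
  proof -
    interpret finite_measure_subalgebra N "obs_filtration N X (ennreal t)"
      by unfold_locales (rule subalgebra_obs_filtration[OF measurable_X])
    let ?E = "\<lambda>f. real_cond_exp N (obs_filtration N X (ennreal t)) f"
    have [measurable]: "M t \<in> N \<rightarrow>\<^sub>M count_space UNIV" using t by (rule measurable_M)
    have int: "integrable N (\<lambda>\<omega>. of_bool (M t \<omega> = i) :: real)" for i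
      by (rule integrable_const_bound[where B = 1]) auto
    have 1: "AE \<omega> in N. \<forall>i. \<pi> t \<omega> $ i = ?E (\<lambda>\<omega>. of_bool (M t \<omega> = i)) \<omega>"
      using cond_prob t by (subst AE_all_countable) (auto simp: conditional_prob_process_def)
    have 2: "AE \<omega> in N. \<forall>i. ?E (\<lambda>\<omega>. of_bool (M t \<omega> = i)) \<omega> \<ge> 0"
      by (subst AE_all_countable) (auto intro!: real_cond_exp_pos)
    have 3: "AE \<omega> in N. ?E (\<lambda>\<omega>. \<Sum>i\<in>UNIV. of_bool (M t \<omega> = i)) \<omega>
        = (\<Sum>i\<in>UNIV. ?E (\<lambda>\<omega>. of_bool (M t \<omega> = i)) \<omega>)"
      by (rule real_cond_exp_sum[OF int])
    have 4: "AE \<omega> in N. ?E (\<lambda>\<omega>. \<Sum>i\<in>UNIV. of_bool (M t \<omega> = i)) \<omega> = 1"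
    proof -
      have "(\<lambda>\<omega>. \<Sum>i\<in>UNIV. of_bool (M t \<omega> = i)) = (\<lambda>_. 1::real)"
        by (simp add: of_bool_def)
      then show ?thesis using real_cond_exp_F_meas[of "\<lambda>_. 1"] by simp
    qed
    show ?thesis
      using 1 2 3 4 by eventually_elim (auto intro!: prob_simplexI)
  qed
  have "AE \<omega> in N. \<forall>q::rat. real_of_rat q \<ge> 0 \<longrightarrow> \<pi> (real_of_rat q) \<omega> \<in> prob_simplex"
    using fixed by (subst AE_all_countable) auto
  moreover have "AE \<omega> in N. \<forall>t\<ge>0. continuous (at_right t) (\<lambda>s. \<pi> s \<omega>)"
    using cond_prob by (simp add: conditional_prob_process_def)
  ultimately show ?thesis
  proof eventually_elim
    case (elim \<omega>)
    show ?case
    proof (intro allI impI)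
      fix t :: real assume t: "t \<ge> 0"
      have "\<exists>u. \<forall>n::nat. t < real_of_rat (u n) \<and> real_of_rat (u n) < t + 1 / real (Suc n)"
        by (intro choice allI of_rat_dense) simp
      then obtain u where u: "\<And>n. t < real_of_rat (u n)" "\<And>n. real_of_rat (u n) < t + 1 / real (Suc n)"
        by blast
      have "filterlim (\<lambda>n. real_of_rat (u n)) (at_right t) sequentially"
        by (rule filterlim_at_right_sequentially) (use u in \<open>auto intro: less_imp_le\<close>)
      moreover have "((\<lambda>s. \<pi> s \<omega>) \<longlongrightarrow> \<pi> t \<omega>) (at_right t)"
        using elim t by (auto simp: continuous_within)
      ultimately have "(\<lambda>n. \<pi> (real_of_rat (u n)) \<omega>) \<longlonglongrightarrow> \<pi> t \<omega>"
        by (rule filterlim_compose[rotated])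
      moreover have "\<pi> (real_of_rat (u n)) \<omega> \<in> prob_simplex" for n
      proof -
        have "real_of_rat (u n) \<ge> 0" using t u(1)[of n] by linarith
        then show ?thesis using elim(1) by blast
      qed
      ultimately show "\<pi> t \<omega> \<in> prob_simplex"
        by (rule closed_sequentially[OF closed_prob_simplex, rotated])
    qed
  qed
qed


section \<open>Gains and costs along a path\<close>

definition adm :: "real \<Rightarrow> 'a \<Rightarrow> ('w, 'a) strategy set"
  where "adm = admissible_strategies N X \<pi> \<rho> K"

text \<open>The horizon is separate from the strategy, so that one strategy can be evaluated at
  several horizons.\<close>

definition running_gain :: "real \<Rightarrow> ('w, 'a) strategy \<Rightarrow> 'w \<Rightarrow> real" where
  "running_gain T s \<omega> = (\<integral>t\<in>{0..T}. exp (- \<rho> * t) *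
     (\<Sum>i\<in>UNIV. c i (policy_at s t \<omega>) * of_bool (M t \<omega> = i)) \<partial>lborel)"

definition switch_term :: "('w, 'a) strategy \<Rightarrow> 'w \<Rightarrow> nat \<Rightarrow> real" where
  "switch_term = (\<lambda>(\<tau>, \<xi>) \<omega> k. if \<tau> (Suc k) \<omega> = \<infinity> then 0 else
     exp (- \<rho> * enn2real (\<tau> (Suc k) \<omega>)) *
     (\<Sum>i\<in>UNIV. K i (\<xi> k \<omega>) (\<xi> (Suc k) \<omega>) * of_bool (M (enn2real (\<tau> (Suc k) \<omega>)) \<omega> = i)))"

lemma performance_eq:
  "performance N M \<rho> c K T s = (\<integral>\<omega>. running_gain T s \<omega> - (\<Sum>k. switch_term s \<omega> k) \<partial>N)"
  by (cases s) (simp add: performance_def running_gain_def switch_term_def)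

lemma switch_term_eq:
  "switch_term (\<tau>, \<xi>) \<omega> k = (if \<tau> (Suc k) \<omega> = \<infinity> then 0 else
     exp (- \<rho> * enn2real (\<tau> (Suc k) \<omega>)) *
     K (M (enn2real (\<tau> (Suc k) \<omega>)) \<omega>) (\<xi> k \<omega>) (\<xi> (Suc k) \<omega>))"
  by (simp add: switch_term_def of_bool_def if_distrib cong: if_cong)

lemma running_gain_eq:
  "running_gain T s \<omega> = (\<integral>t\<in>{0..T}. exp (- \<rho> * t) * c (M t \<omega>) (policy_at s t \<omega>) \<partial>lborel)"
  by (simp add: running_gain_def of_bool_def if_distrib cong: if_cong)

lemma switch_term_nonneg: "switch_term s \<omega> k \<ge> 0"
  using less_imp_le[OF less_trans[OF k0_pos cost_lower]] by (cases s) (simp add: switch_term_eq)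

section \<open>Measurability of strategies\<close>

lemma
  assumes "(\<tau>, \<xi>) \<in> adm T a"
  shows adm_measurable_time: "\<tau> k \<in> borel_measurable N"
    and adm_measurable_policy: "\<xi> k \<in> N \<rightarrow>\<^sub>M count_space UNIV"
proof -
  have stop: "stopping_time (obs_filtration N X) (\<tau> k)"
    and pre: "\<xi> k \<in> pre_sigma (\<tau> k) \<rightarrow>\<^sub>M count_space UNIV"
    using assms by (auto simp: adm_def admissible_strategies_def)
  have sub: "sets (obs_filtration N X t) \<subseteq> sets N" for t
    using subalgebra_obs_filtration[OF measurable_X] by (simp add: subalgebra_def)
  show "\<tau> k \<in> borel_measurable N"
    by (rule measurable_stopping_time[OF stop sub space_obs_filtration])
  \<comment> \<open>At time \<infinity> the condition defining \<open>pre_sigma\<close> concerns the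
    whole set, since \<open>\<tau> k \<omega> \<le> \<infinity>\<close> always holds.\<close>
  have "sets (pre_sigma (\<tau> k)) \<subseteq> sets N"
    using sub[of \<infinity>] sets_pre_sigmaD[OF stop, of _ \<infinity>] by auto
  then show "\<xi> k \<in> N \<rightarrow>\<^sub>M count_space UNIV"
    using pre by (auto simp: measurable_def space_pre_sigma)
qed

lemma adm_mono_time:
  assumes "(\<tau>, \<xi>) \<in> adm T a" "\<omega> \<in> space N"
  shows "mono (\<lambda>k. \<tau> k \<omega>)"
proof (rule incseq_SucI)
  show "\<tau> k \<omega> \<le> \<tau> (Suc k) \<omega>" for k
  proof -
    have "\<tau> k \<omega> < \<tau> (Suc k) \<omega> \<or> \<tau> k \<omega> = \<infinity> \<and> \<tau> (Suc k) \<omega> = \<infinity>"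
      using assms by (simp add: adm_def admissible_strategies_def)
    then show ?thesis by auto
  qed
qed

text \<open>By monotonicity the intervals between successive switches are disjoint. The
  \<open>THE\<close> in \<open>policy_at\<close> relies on this.\<close>

lemma adm_unique_index:
  assumes "(\<tau>, \<xi>) \<in> adm T a" "\<omega> \<in> space N"
    and "\<tau> i \<omega> \<le> t" "t < \<tau> (Suc i) \<omega>" "\<tau> j \<omega> \<le> t" "t < \<tau> (Suc j) \<omega>"
  shows "i = j"
proof -
  have "\<not> Suc m \<le> n" if "t < \<tau> (Suc m) \<omega>" "\<tau> n \<omega> \<le> t" for m n
    using monoD[OF adm_mono_time[OF assms(1,2)], of "Suc m" n] that by auto
  from this[OF assms(4,5)] this[OF assms(6,3)] show ?thesis by simp
qed

lemma measurable_policy_at: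
  assumes "s \<in> adm T a"
  shows "(\<lambda>(\<omega>, t). policy_at s t \<omega>) \<in> N \<Otimes>\<^sub>M borel \<rightarrow>\<^sub>M count_space UNIV"
proof -
  obtain \<tau> \<xi> where s: "s = (\<tau>, \<xi>)" by (cases s)
  note [measurable] = adm_measurable_time[OF assms[unfolded s]] adm_measurable_policy[OF assms[unfolded s]]
  have "(\<lambda>x. THE k. \<tau> k (fst x) \<le> ennreal (snd x) \<and> ennreal (snd x) < \<tau> (Suc k) (fst x))
      \<in> N \<Otimes>\<^sub>M borel \<rightarrow>\<^sub>M count_space UNIV"
  \<comment> \<open>Uniqueness is enough: where all switching times are at most \<open>t\<close> no
    index exists, and \<open>THE\<close> takes one fixed default value.\<close>
  proof (rule measurable_THE[where I = UNIV])
    fix x i j assume "x \<in> space (N \<Otimes>\<^sub>M (borel :: real measure))"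
      "\<tau> i (fst x) \<le> ennreal (snd x) \<and> ennreal (snd x) < \<tau> (Suc i) (fst x)"
      "\<tau> j (fst x) \<le> ennreal (snd x) \<and> ennreal (snd x) < \<tau> (Suc j) (fst x)"
    then show "i = j"
      by (intro adm_unique_index[OF assms[unfolded s], of "fst x" i "ennreal (snd x)" j]) (auto simp: space_pair_measure)
  qed auto
  then show ?thesis
    unfolding s policy_at_def case_prod_beta' prod.sel
    by (rule measurable_compose_countable[rotated]) measurable
qed

section \<open>Bounds on the running gain\<close>

definition cmax :: real where "cmax = (MAX (i, b) \<in> UNIV. \<bar>c i b\<bar>)"

lemma cmax_ge: "\<bar>c i b\<bar> \<le> cmax"
  unfolding cmax_def by (rule Max_ge) (auto intro!: image_eqI[where x = "(i, b)"])

lemma cmax_nonneg: "cmax \<ge> 0"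
  using cmax_ge abs_ge_zero order_trans by blast

lemma measurable_running_integrand:
  assumes "s \<in> adm T' a"
  shows "(\<lambda>(\<omega>, t). indicator {0..T} t * (exp (- \<rho> * t) * c (M t \<omega>) (policy_at s t \<omega>)))
    \<in> borel_measurable (N \<Otimes>\<^sub>M lborel)"
proof -
  note M = measurable_right_continuous_process[OF measurable_M right_cont_M, unfolded case_prod_beta']
  note P = measurable_policy_at[OF assms, unfolded case_prod_beta']
  have "(\<lambda>x. (M (max 0 (snd x)) (fst x), policy_at s (snd x) (fst x)))
      \<in> N \<Otimes>\<^sub>M borel \<rightarrow>\<^sub>M count_space UNIV \<Otimes>\<^sub>M count_space UNIV"
    by (intro measurable_Pair M P)
  \<comment> \<open>For countable types the product of discrete sigma-algebras is discrete, so the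
    table \<open>c\<close> is measurable on it.\<close>
  then have MP: "(\<lambda>x. (M (max 0 (snd x)) (fst x), policy_at s (snd x) (fst x)))
      \<in> N \<Otimes>\<^sub>M borel \<rightarrow>\<^sub>M count_space UNIV"
    by (simp add: pair_measure_countable)
  then have [measurable]: "(\<lambda>x. c (M (max 0 (snd x)) (fst x)) (policy_at s (snd x) (fst x)))
      \<in> borel_measurable (N \<Otimes>\<^sub>M borel)"
    using measurable_compose[OF MP, of "\<lambda>(i, b). c i b" borel] by simp
  have "(\<lambda>x. indicator {0..T} (snd x) *
      (exp (- \<rho> * snd x) * c (M (max 0 (snd x)) (fst x)) (policy_at s (snd x) (fst x))))
      \<in> borel_measurable (N \<Otimes>\<^sub>M borel)"
    by measurable
  \<comment> \<open>The indicator vanishes at negative times, where \<open>max 0 t\<close> and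
    \<open>t\<close> differ.\<close>
  also have "(\<lambda>x. indicator {0..T} (snd x) *
      (exp (- \<rho> * snd x) * c (M (max 0 (snd x)) (fst x)) (policy_at s (snd x) (fst x)))) =
    (\<lambda>(\<omega>, t). indicator {0..T} t * (exp (- \<rho> * t) * c (M t \<omega>) (policy_at s t \<omega>)))"
    by (auto simp: fun_eq_iff indicator_def max_def)
  finally show ?thesis
    by (simp add: measurable_cong_sets[OF sets_pair_measure_cong[OF refl sets_lborel] refl])
qed

lemma running_integrand_bound:
  assumes "t \<ge> 0" shows "\<bar>exp (- \<rho> * t) * c i b\<bar> \<le> cmax"
proof -
  have "exp (- \<rho> * t) \<le> 1" using assms discount by simp
  then have "\<bar>exp (- \<rho> * t) * c i b\<bar> \<le> 1 * cmax"
    unfolding abs_mult using cmax_ge by (intro mult_mono) auto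
  then show ?thesis by simp
qed

lemma running_integrable:
  assumes "s \<in> adm T' a" "\<omega> \<in> space N"
  shows "set_integrable lborel {0..T} (\<lambda>t. exp (- \<rho> * t) * c (M t \<omega>) (policy_at s t \<omega>))"
  unfolding set_integrable_def
proof (rule Bochner_Integration.integrable_bound[where f = "\<lambda>t. indicator {0..T} t * cmax"])
  show "integrable lborel (\<lambda>t. indicator {0..T} t * cmax)"
    by (intro integrable_mult_left integrable_real_indicator) (auto simp: emeasure_lborel_Icc_eq)
  show "(\<lambda>t. indicat_real {0..T} t *\<^sub>R (exp (- \<rho> * t) * c (M t \<omega>) (policy_at s t \<omega>))) \<in> borel_measurable lborel"
    using measurable_Pair2[OF measurable_running_integrand[OF assms(1)] assms(2)] by simp
qed (use running_integrand_bound cmax_nonneg in \<open>auto simp: indicator_def\<close>)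

text \<open>The integrals over \<open>{0..S}\<close> agree and cancel. The rest runs over
  \<open>{S<..T}\<close> and is at most \<open>cmax\<close> times its length. The admissible
  horizons \<open>T'\<close> and \<open>S'\<close> are free, so that extension and truncation are
  both covered.\<close>

lemma running_gain_diff:
  assumes "s \<in> adm T' a" "s' \<in> adm S' a" "\<omega> \<in> space N" "0 \<le> S" "S \<le> T"
    and "\<And>t. t \<le> S \<Longrightarrow> policy_at s' t \<omega> = policy_at s t \<omega>"
  shows "\<bar>running_gain T s \<omega> - running_gain S s' \<omega>\<bar> \<le> cmax * (T - S)"
proof -
  let ?f = "\<lambda>t. exp (- \<rho> * t) * c (M t \<omega>) (policy_at s t \<omega>)"
  have int: "set_integrable lborel A ?f" if "A \<in> sets borel" "A \<subseteq> {0..T}" for A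
    using set_integrable_subset[OF running_integrable[OF assms(1,3), of T]] that by simp
  have "running_gain S s' \<omega> = (\<integral>t\<in>{0..S}. ?f t \<partial>lborel)"
    unfolding running_gain_eq using assms(6) by (intro set_lebesgue_integral_cong) auto
  moreover have "running_gain T s \<omega> = (\<integral>t\<in>{0..S}. ?f t \<partial>lborel) + (\<integral>t\<in>{S<..T}. ?f t \<partial>lborel)"
  proof -
    have "{0..T} = {0..S} \<union> {S<..T}" using assms by auto
    then show ?thesis
      by (simp only: running_gain_eq, intro set_integral_Un int) (use assms(4,5) in auto)
  qed
  moreover have "\<bar>\<integral>t\<in>{S<..T}. ?f t \<partial>lborel\<bar> \<le> (\<integral>t\<in>{S<..T}. cmax \<partial>lborel)"
    unfolding set_lebesgue_integral_def
  proof (rule integral_abs_bound_integral)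
    show "integrable lborel (\<lambda>t. indicator {S<..T} t *\<^sub>R ?f t)"
      using int[of "{S<..T}"] assms(4) by (simp add: set_integrable_def subset_eq)
    show "\<bar>indicat_real {S<..T} t *\<^sub>R ?f t\<bar> \<le> indicator {S<..T} t *\<^sub>R cmax" for t
      using running_integrand_bound[of t] assms(4) by (auto simp: indicator_def)
  qed (use assms in simp)
  moreover have "(\<integral>t\<in>{S<..T}. cmax \<partial>lborel) = cmax * (T - S)"
    using assms(5) by (simp add: set_lebesgue_integral_def)
  ultimately show ?thesis by simp
qed

lemma running_gain_bound:
  assumes "s \<in> adm T' a" "\<omega> \<in> space N" "T \<ge> 0"
  shows "\<bar>running_gain T s \<omega>\<bar> \<le> cmax * T"
proof -
  \<comment> \<open>Horizon 0 integrates over a single point; with \<open>S = 0\<close> the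
    difference estimate thus becomes an absolute bound.\<close>
  have "running_gain 0 s \<omega> = 0"
    unfolding running_gain_def set_lebesgue_integral_def
    by (rule integral_eq_zero_AE, rule eventually_mono[OF AE_lborel_singleton[of 0]]) (auto simp: indicator_def)
  then show ?thesis
    using running_gain_diff[OF assms(1,1,2), of 0 T] assms(3) by simp
qed

text \<open>Measurability comes from Fubini's theorem, integrability from boundedness on a
  probability space.\<close>

lemma running_gain_integrable:
  assumes "s \<in> adm T' a" "T \<ge> 0"
  shows "integrable N (running_gain T s)"
proof (rule integrable_const_bound[where B = "cmax * T"])
  have "(\<lambda>\<omega>. \<integral>t. indicator {0..T} t * (exp (- \<rho> * t) * c (M t \<omega>) (policy_at s t \<omega>)) \<partial>lborel)
      \<in> borel_measurable N"
    by (rule lborel.borel_measurable_lebesgue_integral[OF measurable_running_integrand[OF assms(1)]])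
  then show "running_gain T s \<in> borel_measurable N"
    by (simp add: running_gain_eq[abs_def] set_lebesgue_integral_def)
qed (use running_gain_bound[OF assms(1) _ assms(2)] in auto)

section \<open>Integrability of the switching costs\<close>

lemma measurable_switch_term:
  assumes "s \<in> adm T a" shows "(\<lambda>\<omega>. switch_term s \<omega> k) \<in> borel_measurable N"
proof -
  obtain \<tau> \<xi> where s: "s = (\<tau>, \<xi>)" by (cases s)
  note [measurable] = adm_measurable_time[OF assms[unfolded s]] adm_measurable_policy[OF assms[unfolded s]]
  \<comment> \<open>The jointly measurable chain is composed with the random time;
    \<open>max 0\<close> then disappears because \<open>enn2real\<close> is nonnegative.\<close>
  have "(\<lambda>\<omega>. M (max 0 (enn2real (\<tau> (Suc k) \<omega>))) \<omega>) \<in> N \<rightarrow>\<^sub>M count_space UNIV"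
    using measurable_compose[OF _ measurable_right_continuous_process[OF measurable_M right_cont_M],
        of "\<lambda>\<omega>. (\<omega>, enn2real (\<tau> (Suc k) \<omega>))" N] by simp
  then have [measurable]: "(\<lambda>\<omega>. M (enn2real (\<tau> (Suc k) \<omega>)) \<omega>) \<in> N \<rightarrow>\<^sub>M count_space UNIV"
    by simp
  have "(\<lambda>\<omega>. (M (enn2real (\<tau> (Suc k) \<omega>)) \<omega>, \<xi> k \<omega>, \<xi> (Suc k) \<omega>))
      \<in> N \<rightarrow>\<^sub>M count_space UNIV \<Otimes>\<^sub>M count_space UNIV \<Otimes>\<^sub>M count_space UNIV"
    by measurable
  then have "(\<lambda>\<omega>. (M (enn2real (\<tau> (Suc k) \<omega>)) \<omega>, \<xi> k \<omega>, \<xi> (Suc k) \<omega>)) \<in> N \<rightarrow>\<^sub>M count_space UNIV"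
    by (simp add: pair_measure_countable)
  then have [measurable]: "(\<lambda>\<omega>. K (M (enn2real (\<tau> (Suc k) \<omega>)) \<omega>) (\<xi> k \<omega>) (\<xi> (Suc k) \<omega>)) \<in> borel_measurable N"
    using measurable_compose[of _ _ "count_space UNIV" "\<lambda>(i, b, b'). K i b b'" borel] by simp
  show ?thesis
    unfolding s switch_term_eq by measurable
qed

text \<open>One infinite switching time makes all later ones infinite, so almost every path has
  finitely many nonzero terms. Comparing real series termwise depends on this.\<close>

lemma AE_switch_term_summable:
  assumes "s \<in> adm T a" shows "AE \<omega> in N. summable (switch_term s \<omega>)"
proof -
  obtain \<tau> \<xi> where s: "s = (\<tau>, \<xi>)" by (cases s)
  have "AE \<omega> in N. \<exists>k. \<tau> k \<omega> = \<infinity>"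
    using assms by (auto simp: s adm_def admissible_strategies_def)
  then show ?thesis
    using AE_space
  proof eventually_elim
    case (elim \<omega>)
    then obtain k where k: "\<tau> k \<omega> = \<infinity>" by blast
    have "\<tau> (Suc j) \<omega> = \<infinity>" if "j \<notin> {..k}" for j
      using monoD[OF adm_mono_time[OF assms[unfolded s] elim(2)], of k "Suc j"] that k
      by (simp add: top_unique)
    then show ?case
      by (intro summable_finite[of "{..k}"]) (auto simp: s switch_term_eq)
  qed
qed

text \<open>
  As \<open>\<pi> t\<close> almost surely lies in the simplex for all \<open>t\<close> simultaneously, \<open>K\<close> is at most a constant
  multiple of the filtered cost in the admissibility condition; this replaces the identification of
  the two by optional projection.
\<close>

lemma switching_costs_integrable:
  assumes "s \<in> adm T a" shows "integrable N (\<lambda>\<omega>. \<Sum>k. switch_term s \<omega> k)"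
proof -
  obtain \<tau> \<xi> where s: "s = (\<tau>, \<xi>)" by (cases s)
  note [measurable] = measurable_switch_term[OF assms]
  obtain B where B: "\<And>i b b'. K i b b' \<le> B"
  proof
    show "K i b b' \<le> Max (range (\<lambda>(i, b, b'). K i b b'))" for i b b'
      by (rule Max_ge) (auto intro!: image_eqI[where x = "(i, b, b')"])
  qed
  \<comment> \<open>The arguments are arbitrary: any value of \<open>K\<close> lies between
    \<open>k0\<close> and \<open>B\<close>.\<close>
  have B_pos: "B > 0"
    using B[of undefined undefined undefined] cost_lower[of undefined undefined undefined] k0_pos by linarith
  let ?h = "\<lambda>\<omega> k. if \<tau> (Suc k) \<omega> = \<infinity> then 0 else
    ennreal (exp (- \<rho> * enn2real (\<tau> (Suc k) \<omega>)) *
      switch_cost K (\<xi> k \<omega>) (\<xi> (Suc k) \<omega>) (\<pi> (enn2real (\<tau> (Suc k) \<omega>)) \<omega>))"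
  have fin: "(\<integral>\<^sup>+\<omega>. (\<Sum>k. ?h \<omega> k) \<partial>N) < \<infinity>"
    using assms by (simp add: s adm_def admissible_strategies_def)
  \<comment> \<open>The actual cost is at most \<open>B\<close> and the filtered one at least
    \<open>k0\<close>, under the same discounting; hence the factor \<open>k0 / B\<close>.\<close>
  have "AE \<omega> in N. ennreal (k0 / B * (\<Sum>k. switch_term s \<omega> k)) \<le> (\<Sum>k. ?h \<omega> k)"
    using AE_switch_term_summable[OF assms] AE_cond_prob_simplex
  proof eventually_elim
    case (elim \<omega>)
    have "ennreal (k0 / B * switch_term s \<omega> k) \<le> ?h \<omega> k" for k
    proof (cases "\<tau> (Suc k) \<omega> = \<infinity>")
      case False
      let ?t = "enn2real (\<tau> (Suc k) \<omega>)"
      have "k0 / B * switch_term s \<omega> k = exp (- \<rho> * ?t) * (k0 * (K (M ?t \<omega>) (\<xi> k \<omega>) (\<xi> (Suc k) \<omega>) / B))"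
        using False by (simp add: s switch_term_eq)
      also have "\<dots> \<le> exp (- \<rho> * ?t) * (k0 * 1)"
        using B B_pos k0_pos by (intro mult_left_mono) auto
      also have "\<dots> \<le> exp (- \<rho> * ?t) * switch_cost K (\<xi> k \<omega>) (\<xi> (Suc k) \<omega>) (\<pi> ?t \<omega>)"
        using switch_cost_ge[of k0 K, OF less_imp_le[OF cost_lower]] elim(2) by (intro mult_left_mono) auto
      finally show ?thesis using False by (simp add: ennreal_leI)
    qed (simp add: s switch_term_eq)
    then have "(\<Sum>k. ennreal (k0 / B * switch_term s \<omega> k)) \<le> (\<Sum>k. ?h \<omega> k)"
      by (intro suminf_le) auto
    \<comment> \<open>The extended series equals the real one because the terms are nonnegative and
      summable.\<close>
    also have "(\<Sum>k. ennreal (k0 / B * switch_term s \<omega> k)) = ennreal (\<Sum>k. k0 / B * switch_term s \<omega> k)"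
      using k0_pos B_pos switch_term_nonneg elim(1) by (intro suminf_ennreal2 summable_mult) auto
    finally show ?case by (simp only: suminf_mult[OF elim(1)])
  qed
  then have "(\<integral>\<^sup>+\<omega>. ennreal (k0 / B * (\<Sum>k. switch_term s \<omega> k)) \<partial>N) < \<infinity>"
    by (rule le_less_trans[OF nn_integral_mono_AE fin])
  moreover have "AE \<omega> in N. 0 \<le> k0 / B * (\<Sum>k. switch_term s \<omega> k)"
    using AE_switch_term_summable[OF assms]
    by eventually_elim
       (use k0_pos B_pos in \<open>intro mult_nonneg_nonneg suminf_nonneg switch_term_nonneg; simp\<close>)
  ultimately have "integrable N (\<lambda>\<omega>. k0 / B * (\<Sum>k. switch_term s \<omega> k))"
    by (intro integrableI_nonneg) auto
  from integrable_mult_right[OF this, of "B / k0"] show ?thesis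
    using k0_pos B_pos by simp
qed

section \<open>Comparison of performances\<close>

lemma performance_integrable:
  assumes "s \<in> adm T' a" "T \<ge> 0"
  shows "integrable N (\<lambda>\<omega>. running_gain T s \<omega> - (\<Sum>k. switch_term s \<omega> k))"
  using running_gain_integrable[OF assms] switching_costs_integrable[OF assms(1)] by simp

text \<open>The pathwise comparison holds almost everywhere, namely where both cost series converge,
  and is then integrated; \<open>d\<close> integrates to itself because \<open>N\<close> has mass
  1.\<close>

lemma performance_diff:
  assumes "s \<in> adm T a" "s' \<in> adm T' a" "T \<ge> 0" "T' \<ge> 0"
    and run: "\<And>\<omega>. \<omega> \<in> space N \<Longrightarrow> running_gain T s \<omega> \<le> running_gain T' s' \<omega> + d"
    and cost: "\<And>\<omega> k. \<omega> \<in> space N \<Longrightarrow> switch_term s' \<omega> k \<le> switch_term s \<omega> k"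
  shows "performance N M \<rho> c K T s \<le> performance N M \<rho> c K T' s' + d"
proof -
  have "AE \<omega> in N. running_gain T s \<omega> - (\<Sum>k. switch_term s \<omega> k)
      \<le> (running_gain T' s' \<omega> - (\<Sum>k. switch_term s' \<omega> k)) + d"
    using AE_switch_term_summable[OF assms(1)] AE_switch_term_summable[OF assms(2)] AE_space
  proof eventually_elim
    case (elim \<omega>)
    have "(\<Sum>k. switch_term s' \<omega> k) \<le> (\<Sum>k. switch_term s \<omega> k)"
      using elim cost by (intro suminf_le) auto
    then show ?case using run[OF elim(3)] by simp
  qed
  then have "(\<integral>\<omega>. running_gain T s \<omega> - (\<Sum>k. switch_term s \<omega> k) \<partial>N)
      \<le> (\<integral>\<omega>. (running_gain T' s' \<omega> - (\<Sum>k. switch_term s' \<omega> k)) + d \<partial>N)"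
    using performance_integrable[OF assms(1,3)] performance_integrable[OF assms(2,4)]
    by (intro integral_mono_AE) auto
  also have "\<dots> = (\<integral>\<omega>. running_gain T' s' \<omega> - (\<Sum>k. switch_term s' \<omega> k) \<partial>N) + d"
    using performance_integrable[OF assms(2,4)] by (subst Bochner_Integration.integral_add) (auto simp: prob_space)
  finally show ?thesis unfolding performance_eq .
qed

lemma performance_le:
  assumes "s \<in> adm T a" "T \<ge> 0" shows "performance N M \<rho> c K T s \<le> cmax * T"
proof -
  have "AE \<omega> in N. running_gain T s \<omega> - (\<Sum>k. switch_term s \<omega> k) \<le> cmax * T"
    using AE_switch_term_summable[OF assms(1)] AE_space
  proof eventually_elim
    case (elim \<omega>)
    have "(\<Sum>k. switch_term s \<omega> k) \<ge> 0"
      using elim(1) switch_term_nonneg by (intro suminf_nonneg)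
    then show ?case using running_gain_bound[OF assms(1) elim(2) assms(2)] by simp
  qed
  then have "(\<integral>\<omega>. running_gain T s \<omega> - (\<Sum>k. switch_term s \<omega> k) \<partial>N) \<le> (\<integral>\<omega>. cmax * T \<partial>N)"
    by (intro integral_mono_AE performance_integrable[OF assms]) auto
  then show ?thesis by (simp add: performance_eq prob_space)
qed

section \<open>Never switching, extension and truncation\<close>

lemma adm_nonempty: "adm T a \<noteq> {}"
proof -
  \<comment> \<open>Never switch: every time after index 0 is \<infinity>, so 1 is the index
    witnessing finitely many switches.\<close>
  have "((\<lambda>k \<omega>. if k = 0 then 0 else \<infinity>), (\<lambda>k \<omega>. a)) \<in> adm T a"
    unfolding adm_def admissible_strategies_def
    by (auto simp: stopping_time_const intro!: exI[of _ 1])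
  then show ?thesis by blast
qed

text \<open>The horizon enters admissibility only through the upper bound on the switching
  times.\<close>

lemma adm_mono:
  assumes "s \<in> adm S a" "S \<le> T" shows "s \<in> adm T a"
proof -
  have "x \<le> ennreal T" if "x \<le> ennreal S" for x
    using that ennreal_leI[OF assms(2)] by (rule order_trans)
  then show ?thesis
    using assms(1) unfolding adm_def admissible_strategies_def
    by (elim CollectE case_prodE, intro CollectI case_prodI2') (simp, metis)
qed

text \<open>A cancelled switch is sent to \<infinity>, where it costs nothing and never takes
  effect; for \<open>S \<ge> 0\<close> a switch exactly at \<open>S\<close> is kept.\<close>

definition truncate :: "real \<Rightarrow> ('w, 'a) strategy \<Rightarrow> ('w, 'a) strategy" where
  "truncate S = (\<lambda>(\<tau>, \<xi>). (\<lambda>k \<omega>. if \<tau> k \<omega> \<le> ennreal S then \<tau> k \<omega> else \<infinity>, \<xi>))"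

text \<open>For \<open>t \<le> S\<close>, comparing a switching time with \<open>t\<close> gives the
  same answer before and after truncation, so \<open>THE\<close> selects the same index.\<close>

lemma policy_at_truncate: "t \<le> S \<Longrightarrow> policy_at (truncate S s) t \<omega> = policy_at s t \<omega>"
proof -
  assume t: "t \<le> S"
  obtain \<tau> \<xi> where s: "s = (\<tau>, \<xi>)" by (cases s)
  have "(if u \<le> ennreal S then u else \<infinity>) \<le> ennreal t \<longleftrightarrow> u \<le> ennreal t" for u
    using order_trans[OF _ ennreal_leI[OF t], of u] by (auto simp: top_unique)
  then show ?thesis
    by (simp add: s truncate_def policy_at_def flip: not_le)
qed

lemma switch_term_truncate: "switch_term (truncate S s) \<omega> k \<le> switch_term s \<omega> k"
  using switch_term_nonneg[of s \<omega> k] by (cases s) (auto simp: truncate_def switch_term_def)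

lemma truncate_adm:
  assumes "s \<in> adm T a" shows "truncate S s \<in> adm S a"
proof -
  obtain \<tau> \<xi> where s: "s = (\<tau>, \<xi>)" by (cases s)
  let ?\<tau> = "\<lambda>k \<omega>. if \<tau> k \<omega> \<le> ennreal S then \<tau> k \<omega> else \<infinity>"
  have A: "\<And>\<omega>. \<omega> \<in> space N \<Longrightarrow> \<tau> 0 \<omega> = 0 \<and> \<xi> 0 \<omega> = a"
    "\<And>\<omega> k. \<omega> \<in> space N \<Longrightarrow> \<tau> k \<omega> < \<tau> (Suc k) \<omega> \<or> \<tau> k \<omega> = \<infinity> \<and> \<tau> (Suc k) \<omega> = \<infinity>"
    "\<And>k. stopping_time (obs_filtration N X) (\<tau> k)"
    "\<And>k. \<xi> k \<in> pre_sigma (\<tau> k) \<rightarrow>\<^sub>M count_space UNIV"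
    "AE \<omega> in N. \<exists>k. \<tau> k \<omega> = \<infinity>"
    "(\<integral>\<^sup>+ \<omega>. (\<Sum>k. if \<tau> (Suc k) \<omega> = \<infinity> then 0 else
        ennreal (exp (- \<rho> * enn2real (\<tau> (Suc k) \<omega>)) *
          switch_cost K (\<xi> k \<omega>) (\<xi> (Suc k) \<omega>) (\<pi> (enn2real (\<tau> (Suc k) \<omega>)) \<omega>))) \<partial>N) < \<infinity>"
    using assms by (auto simp: s adm_def admissible_strategies_def)
  have stop: "stopping_time (obs_filtration N X) (?\<tau> k)" for k
  proof
    fix t :: ennreal
    \<comment> \<open>A cancelled time is at most \<open>t\<close> only for
      \<open>t = \<infinity>\<close>. Otherwise the event is decided at time
      \<open>min t (ennreal S)\<close>, hence at \<open>t\<close>.\<close>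
    have "?\<tau> k \<omega> \<le> t \<longleftrightarrow> t = \<infinity> \<or> \<tau> k \<omega> \<le> min t (ennreal S)" for \<omega>
      by (auto simp: top_unique)
    moreover have "Measurable.pred (obs_filtration N X t) (\<lambda>\<omega>. \<tau> k \<omega> \<le> min t (ennreal S))"
      by (rule stopping_time_le_const[OF A(3)]) simp
    ultimately show "Measurable.pred (obs_filtration N X t) (\<lambda>\<omega>. ?\<tau> k \<omega> \<le> t)"
      by simp
  qed
  \<comment> \<open>Truncation never lowers a time, so the sigma-algebra can only grow and
    \<open>\<xi> k\<close> remains measurable.\<close>
  have "sets (pre_sigma (\<tau> k)) \<subseteq> sets (pre_sigma (?\<tau> k))" for k
    by (rule mono_pre_sigma[OF A(3) stop]) simp
  then have pre: "\<xi> k \<in> pre_sigma (?\<tau> k) \<rightarrow>\<^sub>M count_space UNIV" for k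
    using A(4)[of k] by (auto simp: measurable_def space_pre_sigma)
  have "(\<integral>\<^sup>+ \<omega>. (\<Sum>k. if ?\<tau> (Suc k) \<omega> = \<infinity> then 0 else
        ennreal (exp (- \<rho> * enn2real (?\<tau> (Suc k) \<omega>)) *
          switch_cost K (\<xi> k \<omega>) (\<xi> (Suc k) \<omega>) (\<pi> (enn2real (?\<tau> (Suc k) \<omega>)) \<omega>))) \<partial>N)
    \<le> (\<integral>\<^sup>+ \<omega>. (\<Sum>k. if \<tau> (Suc k) \<omega> = \<infinity> then 0 else
        ennreal (exp (- \<rho> * enn2real (\<tau> (Suc k) \<omega>)) *
          switch_cost K (\<xi> k \<omega>) (\<xi> (Suc k) \<omega>) (\<pi> (enn2real (\<tau> (Suc k) \<omega>)) \<omega>))) \<partial>N)"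
    by (intro nn_integral_mono suminf_le) auto
  then have fin: "(\<integral>\<^sup>+ \<omega>. (\<Sum>k. if ?\<tau> (Suc k) \<omega> = \<infinity> then 0 else
        ennreal (exp (- \<rho> * enn2real (?\<tau> (Suc k) \<omega>)) *
          switch_cost K (\<xi> k \<omega>) (\<xi> (Suc k) \<omega>) (\<pi> (enn2real (?\<tau> (Suc k) \<omega>)) \<omega>))) \<partial>N) < \<infinity>"
    using A(6) by (rule le_less_trans)
  have "AE \<omega> in N. \<exists>k. ?\<tau> k \<omega> = \<infinity>"
    using A(5) by eventually_elim auto
  \<comment> \<open>If only the later time is cancelled, the earlier one is finite, being at most
    \<open>ennreal S\<close>; if the earlier is cancelled, so is the later.\<close>
  moreover have "?\<tau> k \<omega> < ?\<tau> (Suc k) \<omega> \<or> ?\<tau> k \<omega> = \<infinity> \<and> ?\<tau> (Suc k) \<omega> = \<infinity>" if "\<omega> \<in> space N" for \<omega> k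
    using A(2)[OF that, of k] by (auto simp: less_top top_unique dest: le_less_trans[OF _ ennreal_less_top])
  ultimately show ?thesis
    unfolding s truncate_def adm_def admissible_strategies_def
    using A(1) stop pre fin by simp
qed

section \<open>Lipschitz continuity in the horizon\<close>

lemma value_function_diff:
  assumes "0 \<le> S" "S \<le> T"
  shows "\<bar>value_function N X M \<pi> \<rho> c K T a - value_function N X M \<pi> \<rho> c K S a\<bar> \<le> cmax * (T - S)"
proof -
  let ?J = "performance N M \<rho> c K"
  let ?U = "\<lambda>T. value_function N X M \<pi> \<rho> c K T a"
  have U: "?U T = (SUP s\<in>adm T a. ?J T s)" for T
    by (simp add: value_function_def adm_def)
  have le_U: "?J T s \<le> ?U T" if "s \<in> adm T a" "T \<ge> 0" for s T
    unfolding U using that performance_le by (intro cSUP_upper) (auto intro!: bdd_aboveI2)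
  \<comment> \<open>Keep the strategy of the shorter horizon: its costs are the same, and only the
    gains over \<open>{S<..T}\<close> differ.\<close>
  have "?U S \<le> ?U T + cmax * (T - S)"
  proof (subst U, rule cSUP_least[OF adm_nonempty])
    fix s assume s: "s \<in> adm S a"
    have "?J S s \<le> ?J T s + cmax * (T - S)"
    proof (rule performance_diff[OF s adm_mono[OF s assms(2)]])
      fix \<omega> assume \<omega>: "\<omega> \<in> space N"
      show "running_gain S s \<omega> \<le> running_gain T s \<omega> + cmax * (T - S)"
        using running_gain_diff[OF s s \<omega> assms] by (simp add: abs_le_iff algebra_simps)
    qed (use assms in auto)
    then show "?J S s \<le> ?U T + cmax * (T - S)"
      using le_U[OF adm_mono[OF s assms(2)]] assms by simp
  qed
  \<comment> \<open>Cancel the switches after \<open>S\<close>: costs do not rise, and only the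
    gains over \<open>{S<..T}\<close> are given up.\<close>
  moreover have "?U T \<le> ?U S + cmax * (T - S)"
  proof (subst U, rule cSUP_least[OF adm_nonempty])
    fix s assume s: "s \<in> adm T a"
    have "?J T s \<le> ?J S (truncate S s) + cmax * (T - S)"
    proof (rule performance_diff[OF s truncate_adm[OF s]])
      fix \<omega> assume \<omega>: "\<omega> \<in> space N"
      show "running_gain T s \<omega> \<le> running_gain S (truncate S s) \<omega> + cmax * (T - S)"
        using running_gain_diff[OF s truncate_adm[OF s] \<omega> assms policy_at_truncate[of _ S s \<omega>]]
        by (simp add: abs_le_iff algebra_simps)
    qed (use assms switch_term_truncate in auto)
    then show "?J T s \<le> ?U S + cmax * (T - S)"
      using le_U[OF truncate_adm[OF s] assms(1)] by simp
  qed
  ultimately show ?thesis by (simp add: abs_le_iff)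
qed

end

theorem lemma4p5:
  fixes P :: "real ^ 'e::finite \<Rightarrow> 'w measure"
    and Q :: "real ^ 'e ^ 'e"
    and lam :: "'e \<Rightarrow> real"
    and \<nu> :: "'e \<Rightarrow> (real ^ 'd::finite) measure"
    and M :: "real \<Rightarrow> 'w \<Rightarrow> 'e"
    and Xi :: "'e \<Rightarrow> real \<Rightarrow> 'w \<Rightarrow> real ^ 'd"
    and X :: "real \<Rightarrow> 'w \<Rightarrow> real ^ 'd"
    and \<pi> :: "real ^ 'e \<Rightarrow> real \<Rightarrow> 'w \<Rightarrow> real ^ 'e"
    and c :: "'e \<Rightarrow> 'a::finite \<Rightarrow> real"
    and K :: "'e \<Rightarrow> 'a \<Rightarrow> 'a \<Rightarrow> real"
    and \<rho> k0 T0 :: real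
  assumes model: "\<And>p. p \<in> prob_simplex \<Longrightarrow>
        hidden_markov_observation (P p) p Q lam \<nu> M Xi X"
    and cond_prob: "\<And>p. p \<in> prob_simplex \<Longrightarrow> conditional_prob_process (P p) X M (\<pi> p)"
    and discount: "\<rho> \<ge> 0"
    and triangle: "\<And>i a b b'. K i a b + K i b b' \<ge> K i a b'"
    and k0_pos: "k0 > 0"
    and cost_lower: "\<And>i a b. K i a b > k0"
    and T0_pos: "T0 > 0"
  shows "\<forall>p\<in>prob_simplex. \<forall>T\<in>{0<..T0}. \<forall>S\<in>{0<..T0}. \<forall>a.
      \<bar>value_function (P p) X M (\<pi> p) \<rho> c K T a - value_function (P p) X M (\<pi> p) \<rho> c K S a\<bar>
        \<le> (MAX (i, b) \<in> UNIV. \<bar>c i b\<bar>) * \<bar>T - S\<bar>"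
proof (intro ballI allI)
  fix p :: "real ^ 'e" and T S :: real and a :: 'a
  assume p: "p \<in> prob_simplex" and T: "T \<in> {0<..T0}" and S: "S \<in> {0<..T0}"
  note m = model[OF p, unfolded hidden_markov_observation_def markov_chain_process_def]
  interpret prob_space "P p" using m by blast
  interpret switching_model "P p" M X "\<pi> p" c K \<rho> k0
    by unfold_locales (use m cond_prob[OF p] discount k0_pos cost_lower in auto)
  \<comment> \<open>The estimate is available for ordered horizons; the absolute values make the two
    orders symmetric.\<close>
  show "\<bar>value_function (P p) X M (\<pi> p) \<rho> c K T a - value_function (P p) X M (\<pi> p) \<rho> c K S a\<bar>
      \<le> (MAX (i, b) \<in> UNIV. \<bar>c i b\<bar>) * \<bar>T - S\<bar>"
    using value_function_diff[of S T a] value_function_diff[of T S a] T S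
    by (cases "S \<le> T") (auto simp: cmax_def abs_minus_commute)
qed

end
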